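(* There exists a sequence of positive real numbers $(b_r)_{r\ge 2}$ with $b_r \sim r/e$ as $r \to \infty$ such that the following holds for every integer $r \ge 2$. Let $d = d(n)$ be a sequence of positive integers with $d/\log n \to \infty$ and $(\log d)/\log n \to 0$ as $n \to \infty$. Then for all sufficiently large $n$ there exists an $(r+1)$-graph $H_n$ on $n$ vertices with maximum $r$-degree $d$ satisfying $$\alpha(H_n) \ \le\ b_r \Bigl(\frac{n}{d}\log \frac{n}{d}\Bigr)^{1/r}.$$
   Context: An $(r+1)$-graph is a hypergraph on a finite vertex set all of whose edges are $(r+1)$-element subsets of the vertex set. The maximum $r$-degree of an $(r+1)$-graph $H$ is the maximum, over all $r$-element sets $R$ of vertices, of the number of edges of $H$ containing $R$. An independent set in $H$ is a set of vertices containing no edge of $H$, and $\alpha(H)$ is the maximum size of an independent set in $H$. All logarithms are natural. The notation $b_r \sim r/e$ means $b_r/(r/e) \to 1$ as $r\to\infty$, where $e$ is the base of the natural logarithm. *)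

theory Defs
  imports Complex_Main
begin

definition uniform_hypergraph :: "nat \<Rightarrow> 'a set \<Rightarrow> 'a set set \<Rightarrow> bool" where
  "uniform_hypergraph k V E \<longleftrightarrow> finite V \<and> (\<forall>e\<in>E. e \<subseteq> V \<and> card e = k)"

definition set_degree :: "'a set set \<Rightarrow> 'a set \<Rightarrow> nat" where
  "set_degree E R = card {e \<in> E. R \<subseteq> e}"

(* Only meaningful if V is finite with at least r elements, otherwise Max has no proper value. *)
definition max_degree :: "nat \<Rightarrow> 'a set \<Rightarrow> 'a set set \<Rightarrow> nat" where
  "max_degree r V E = Max {set_degree E R | R. R \<subseteq> V \<and> card R = r}"

definition independent_set :: "'a set \<Rightarrow> 'a set set \<Rightarrow> 'a set \<Rightarrow> bool" where
  "independent_set V E S \<longleftrightarrow> S \<subseteq> V \<and> (\<forall>e\<in>E. \<not> e \<subseteq> S)"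

definition independence_number :: "'a set \<Rightarrow> 'a set set \<Rightarrow> nat" where
  "independence_number V E = Max {card S | S. independent_set V E S}"

end

(* Keep each (r+1)-subset of an n-set independently with probability p = d/(4n).  An r-degree has
   mean at most d/4, so by an exponential moment and d >> log n no r-degree exceeds d.  A k-set is
   independent with probability (1 - p)^(k choose (r+1)), and the union bound over k-sets succeeds
   once k^r is about 24 (r+1)! (n/d) log(n/d); here log d = o(log n) gives log n <= 2 log(n/d).
   Adding edges while some r-degree is below d makes the maximum r-degree exactly d without
   increasing the independence number.  Any constant in place of 24 disappears in
   b_r = (24 (r+1)!)^(1/r) ~ r/e. *)

theory Submission
  imports Defs "HOL-Real_Asymp.Real_Asymp"
begin

section \<open>The random hypergraph, with probabilities as finite weighted sums\<close>

text \<open>Expanding the product over \<open>X\<close>, each \<open>e\<close> contributes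
  \<open>p * c e\<close> if chosen and \<open>1 - p\<close> if not. With \<open>c = 1\<close> this
  gives total mass 1; other choices of \<open>c\<close> give exponential moments of degrees and
  probabilities of independence.\<close>

lemma sum_Pow_weighted_prod:
  fixes p :: real
  assumes "finite X"
  shows "(\<Sum>E\<in>Pow X. p ^ card E * (1 - p) ^ card (X - E) * (\<Prod>e\<in>E. c e))
       = (\<Prod>e\<in>X. p * c e + (1 - p))"
  by (simp add: prod_add[OF assms] prod.distrib mult_ac)

lemma card_supersets_Suc:
  assumes "finite V" "R \<subseteq> V" "card R = r"
  shows "card {e. e \<subseteq> V \<and> card e = Suc r \<and> R \<subseteq> e} = card V - r"
proof -
  have finR: "finite R"
    using assms finite_subset by blast
  have "bij_betw (\<lambda>x. insert x R) (V - R) {e. e \<subseteq> V \<and> card e = Suc r \<and> R \<subseteq> e}"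
    unfolding bij_betw_def
  proof
    show "inj_on (\<lambda>x. insert x R) (V - R)"
      by (auto simp: inj_on_def)
    show "(\<lambda>x. insert x R) ` (V - R) = {e. e \<subseteq> V \<and> card e = Suc r \<and> R \<subseteq> e}"
    proof (intro equalityI subsetI)
      fix e assume "e \<in> {e. e \<subseteq> V \<and> card e = Suc r \<and> R \<subseteq> e}"
      then have e: "e \<subseteq> V" "card e = Suc r" "R \<subseteq> e" by auto
      then have "card (e - R) = 1"
        using finR assms by (simp add: card_Diff_subset)
      then obtain x where "e - R = {x}"
        by (auto simp: card_1_singleton_iff)
      then have "e = insert x R" "x \<in> V - R"
        using e by auto
      then show "e \<in> (\<lambda>x. insert x R) ` (V - R)" by blast
    qed (use assms finR in auto)
  qed
  then have "card {e. e \<subseteq> V \<and> card e = Suc r \<and> R \<subseteq> e} = card (V - R)"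
    by (simp add: bij_betw_same_card)
  then show ?thesis
    using assms finR by (simp add: card_Diff_subset)
qed

text \<open>A first-moment argument: a nonnegative penalty has mean below 1, so some edge set has
  penalty below 1, while one \<open>r\<close>-set of degree above \<open>d\<close> or one
  independent \<open>k\<close>-set would already cost at least 1.\<close>

lemma exists_hypergraph_low_degree_no_large_independent:
  fixes p :: real and V :: "'a set"
  assumes V: "finite V" and p: "0 \<le> p" "p \<le> 1"
    and small: "real (card V choose r) * (1 + 2 * p) ^ card V * exp (- real d)
      + real (card V choose k) * (1 - p) ^ (k choose Suc r) < 1"
  shows "\<exists>E. uniform_hypergraph (Suc r) V E \<and>
    (\<forall>R. R \<subseteq> V \<longrightarrow> card R = r \<longrightarrow> set_degree E R \<le> d) \<and>
    (\<forall>S. S \<subseteq> V \<longrightarrow> card S = k \<longrightarrow> (\<exists>e\<in>E. e \<subseteq> S))"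
proof -
  define X where "X = {e. e \<subseteq> V \<and> card e = Suc r}"
  define RS where "RS = {R. R \<subseteq> V \<and> card R = r}"
  define KS where "KS = {S. S \<subseteq> V \<and> card S = k}"
  \<comment> \<open>The probability that exactly \<open>E\<close> is chosen from the possible edges
    \<open>X\<close>.\<close>
  define w where "w E = p ^ card E * (1 - p) ^ card (X - E)" for E :: "'a set set"
  \<comment> \<open>This is \<open>exp\<close> of the degree of \<open>R\<close>, and
    \<open>ind\<close> below is the 0/1 indicator that \<open>S\<close> is independent. Both are
    written as products over \<open>E\<close> so that \<open>sum_Pow_weighted_prod\<close> evaluates
    their means.\<close>
  define deg where "deg E R = (\<Prod>e\<in>E. if R \<subseteq> e then exp 1 else 1 :: real)" for E :: "'a set set" and R
  define ind where "ind E S = (\<Prod>e\<in>E. if e \<subseteq> S then 0 else 1 :: real)" for E :: "'a set set" and S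
  define F where "F E = (\<Sum>R\<in>RS. deg E R * exp (- real d)) + (\<Sum>S\<in>KS. ind E S)" for E
  have fin: "finite X" "finite RS" "finite KS"
    using V by (auto simp: X_def RS_def KS_def)
  have w0: "w E \<ge> 0" for E
    using p by (simp add: w_def)
  have w1: "(\<Sum>E\<in>Pow X. w E) = 1"
    using sum_Pow_weighted_prod[OF fin(1), of p "\<lambda>_. 1"] by (simp add: w_def)
  have mean_deg: "(\<Sum>E\<in>Pow X. w E * deg E R) \<le> (1 + 2 * p) ^ card V" if "R \<in> RS" for R
  proof -
    have R: "R \<subseteq> V" "card R = r" using that by (auto simp: RS_def)
    have "(\<Sum>E\<in>Pow X. w E * deg E R) = (\<Prod>e\<in>X. p * (if R \<subseteq> e then exp 1 else 1) + (1 - p))"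
      unfolding w_def deg_def by (rule sum_Pow_weighted_prod[OF fin(1)])
    also have "\<dots> = (\<Prod>e\<in>X. if R \<subseteq> e then p * exp 1 + (1 - p) else 1)"
      by (intro prod.cong) auto
    also have "\<dots> = (\<Prod>e\<in>{e \<in> X. R \<subseteq> e}. p * exp 1 + (1 - p))"
      using fin(1) by (subst prod.inter_filter) auto
    also have "\<dots> = (p * exp 1 + (1 - p)) ^ (card V - r)"
      using card_supersets_Suc[OF V R] by (simp add: X_def conj_assoc)
    \<comment> \<open>The crude bound \<open>exp 1 \<le> 3\<close> produces the constant 2.\<close>
    also have "\<dots> \<le> (1 + 2 * p) ^ (card V - r)"
    proof (rule power_mono)
      have "p * exp 1 \<le> p * 3"
        using p exp_le by (intro mult_left_mono) auto
      then show "p * exp 1 + (1 - p) \<le> 1 + 2 * p" by simp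
      show "0 \<le> p * exp 1 + (1 - p)" using p by simp
    qed
    also have "\<dots> \<le> (1 + 2 * p) ^ card V"
      using p by (intro power_increasing) auto
    finally show ?thesis .
  qed
  have mean_ind: "(\<Sum>E\<in>Pow X. w E * ind E S) = (1 - p) ^ (k choose Suc r)" if "S \<in> KS" for S
  proof -
    have S: "S \<subseteq> V" "card S = k" using that by (auto simp: KS_def)
    have "(\<Sum>E\<in>Pow X. w E * ind E S) = (\<Prod>e\<in>X. p * (if e \<subseteq> S then 0 else 1) + (1 - p))"
      unfolding w_def ind_def by (rule sum_Pow_weighted_prod[OF fin(1)])
    also have "\<dots> = (\<Prod>e\<in>X. if e \<subseteq> S then 1 - p else 1)"
      by (intro prod.cong) auto
    also have "\<dots> = (\<Prod>e\<in>{e \<in> X. e \<subseteq> S}. 1 - p)"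
      using fin(1) by (subst prod.inter_filter) auto
    also have "{e \<in> X. e \<subseteq> S} = {e. e \<subseteq> S \<and> card e = Suc r}"
      using S by (auto simp: X_def)
    also have "(\<Prod>e\<in>\<dots>. 1 - p) = (1 - p) ^ (k choose Suc r)"
      using n_subsets[OF finite_subset[OF S(1) V], of "Suc r"] S by simp
    finally show ?thesis .
  qed
  have "(\<Sum>E\<in>Pow X. w E * F E)
      = (\<Sum>R\<in>RS. (\<Sum>E\<in>Pow X. w E * deg E R) * exp (- real d)) + (\<Sum>S\<in>KS. \<Sum>E\<in>Pow X. w E * ind E S)"
    unfolding F_def distrib_left sum.distrib sum_distrib_left sum_distrib_right
    by (subst (1 2) sum.swap) (simp add: mult_ac)
  also have "\<dots> \<le> (\<Sum>R\<in>RS. (1 + 2 * p) ^ card V * exp (- real d)) + (\<Sum>S\<in>KS. (1 - p) ^ (k choose Suc r))"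
    by (intro add_mono sum_mono mult_right_mono) (simp_all add: mean_deg mean_ind)
  also have "\<dots> = real (card V choose r) * (1 + 2 * p) ^ card V * exp (- real d)
      + real (card V choose k) * (1 - p) ^ (k choose Suc r)"
    using n_subsets[OF V] by (simp add: RS_def KS_def)
  finally have mean: "(\<Sum>E\<in>Pow X. w E * F E) < 1"
    using small by linarith
  \<comment> \<open>The weights are nonnegative with sum 1, so \<open>F\<close> cannot be at least 1
    everywhere when its mean is below 1.\<close>
  have "\<exists>E\<in>Pow X. F E < 1"
  proof (rule ccontr)
    assume "\<not> ?thesis"
    then have "(\<Sum>E\<in>Pow X. w E * 1) \<le> (\<Sum>E\<in>Pow X. w E * F E)"
      by (intro sum_mono mult_left_mono w0) (auto simp: not_less)
    then show False using mean w1 by simp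
  qed
  then obtain E where E: "E \<subseteq> X" "F E < 1" by auto
  have finE: "finite E" using E fin finite_subset by auto
  have nonneg: "deg E R \<ge> 0" "ind E S \<ge> 0" for R S
    by (auto simp: deg_def ind_def intro!: prod_nonneg)
  have "set_degree E R \<le> d" if "R \<in> RS" for R
  proof (rule ccontr)
    assume "\<not> set_degree E R \<le> d"
    then have "1 \<le> exp (real (set_degree E R) - real d)" by simp
    also have "\<dots> = deg E R * exp (- real d)"
      using finE by (simp add: deg_def set_degree_def flip: prod.inter_filter exp_of_nat_mult exp_add)
    also have "\<dots> \<le> (\<Sum>R\<in>RS. deg E R * exp (- real d))"
      by (rule member_le_sum) (use that fin nonneg in auto)
    also have "\<dots> \<le> F E"
      unfolding F_def using nonneg by (simp add: sum_nonneg)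
    finally show False using E by simp
  qed
  moreover have "\<exists>e\<in>E. e \<subseteq> S" if "S \<in> KS" for S
  proof (rule ccontr)
    assume "\<not> ?thesis"
    then have "1 = ind E S"
      by (simp add: ind_def prod.neutral)
    also have "\<dots> \<le> (\<Sum>S\<in>KS. ind E S)"
      by (rule member_le_sum) (use that fin nonneg in auto)
    also have "\<dots> \<le> F E"
      unfolding F_def using nonneg by (simp add: sum_nonneg)
    finally show False using E by simp
  qed
  moreover have "uniform_hypergraph (Suc r) V E"
    using V E(1) by (auto simp: uniform_hypergraph_def X_def)
  ultimately show ?thesis
    by (intro exI[of _ E] conjI) (auto simp: RS_def KS_def)
qed

section \<open>Exact maximum degree, and bounding the independence number\<close>

text \<open>Take a maximal edge set above \<open>E\<close> that keeps all \<open>r\<close>-degrees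
  at most \<open>d\<close>. If every degree were strictly below \<open>d\<close>, one more edge
  could be added, since it raises each degree by at most 1.\<close>

lemma extend_to_max_degree_eq:
  assumes E: "uniform_hypergraph (Suc r) V E"
    and deg: "\<And>R. R \<subseteq> V \<Longrightarrow> card R = r \<Longrightarrow> set_degree E R \<le> d"
    and d: "d + r \<le> card V"
  shows "\<exists>E'. E \<subseteq> E' \<and> uniform_hypergraph (Suc r) V E' \<and> max_degree r V E' = d"
proof -
  have V: "finite V" using E by (simp add: uniform_hypergraph_def)
  define P where "P E' \<longleftrightarrow> E \<subseteq> E' \<and> uniform_hypergraph (Suc r) V E' \<and>
      (\<forall>R. R \<subseteq> V \<longrightarrow> card R = r \<longrightarrow> set_degree E' R \<le> d)" for E'
  have sub: "{E'. P E'} \<subseteq> Pow (Pow V)"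
    by (auto simp: P_def uniform_hypergraph_def)
  then have "finite {E'. P E'}"
    using V finite_subset by blast
  moreover have "{E'. P E'} \<noteq> {}"
    using E deg by (auto simp: P_def)
  ultimately obtain M where M: "P M" "\<And>E'. P E' \<Longrightarrow> M \<subseteq> E' \<Longrightarrow> E' = M"
    using finite_has_maximal[of "{E'. P E'}"] by auto
  have finM: "finite M"
    using M(1) sub V finite_subset by blast
  let ?D = "{set_degree M R | R. R \<subseteq> V \<and> card R = r}"
  have D: "finite ?D"
    using V by (auto intro: finite_subset[of _ "set_degree M ` Pow V"])
  have "\<exists>R. R \<subseteq> V \<and> card R = r \<and> set_degree M R = d"
  proof (rule ccontr)
    assume none: "\<not> ?thesis"
    then have lt: "set_degree M R < d" if "R \<subseteq> V" "card R = r" for R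
      using M(1) that none unfolding P_def by (metis le_neq_implies_less)
    obtain R where R: "R \<subseteq> V" "card R = r"
      using d by (meson add_leD2 obtain_subset_with_card_n)
    \<comment> \<open>\<open>R\<close> lies in fewer than \<open>d\<close> edges of
      \<open>M\<close>, but in \<open>card V - r \<ge> d\<close> sets of size \<open>Suc r\<close>,
      so one of these is still missing.\<close>
    have "{e \<in> M. R \<subseteq> e} \<noteq> {e. e \<subseteq> V \<and> card e = Suc r \<and> R \<subseteq> e}"
      using lt[OF R] card_supersets_Suc[OF V R] d by (auto simp: set_degree_def)
    then obtain e where e: "e \<subseteq> V" "card e = Suc r" "e \<notin> M"
      using M(1) by (auto simp: P_def uniform_hypergraph_def)
    have "set_degree (insert e M) R' \<le> d" if "R' \<subseteq> V" "card R' = r" for R'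
    proof -
      have "set_degree (insert e M) R' \<le> card (insert e {x \<in> M. R' \<subseteq> x})"
        unfolding set_degree_def using finM by (intro card_mono) auto
      also have "\<dots> \<le> Suc (set_degree M R')"
        unfolding set_degree_def by (rule card_insert_le_m1) (use finM in auto)
      finally show ?thesis using lt[OF that] by simp
    qed
    then have "P (insert e M)"
      using M(1) e by (auto simp: P_def uniform_hypergraph_def)
    then show False using M(2) e by blast
  qed
  then have "max_degree r V M = d"
    unfolding max_degree_def using M(1) by (intro Max_eqI D) (auto simp: P_def)
  then show ?thesis using M(1) by (auto simp: P_def)
qed

lemma independence_number_le:
  assumes E: "uniform_hypergraph (Suc r) V E"
    and k: "\<And>S. S \<subseteq> V \<Longrightarrow> card S = Suc k \<Longrightarrow> \<exists>e\<in>E. e \<subseteq> S"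
  shows "independence_number V E \<le> k"
proof -
  have V: "finite V" using E by (simp add: uniform_hypergraph_def)
  have "finite {card S | S. independent_set V E S}"
    using V by (auto intro: finite_subset[of _ "card ` Pow V"] simp: independent_set_def)
  \<comment> \<open>Edges have positive size, so the empty set is independent and the
    \<open>Max\<close> ranges over a nonempty set.\<close>
  moreover have "independent_set V E {}"
    using E by (auto simp: independent_set_def uniform_hypergraph_def)
  moreover have "card S \<le> k" if S: "independent_set V E S" for S
  proof (rule ccontr)
    assume "\<not> card S \<le> k"
    then obtain T where "T \<subseteq> S" "card T = Suc k"
      by (meson not_less_eq_eq obtain_subset_with_card_n)
    then show False
      using k[of T] S unfolding independent_set_def by blast
  qed
  ultimately show ?thesis
    unfolding independence_number_def by (subst Max_le_iff) auto
qed

section \<open>Lower bounds for binomial coefficients\<close>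

text \<open>The right-hand side is the falling product \<open>k * (k - 1) * ... * (k - m)\<close>,
  whose \<open>m\<close> factors after the first are all at least \<open>k - m\<close>.\<close>

lemma binomial_ge_power:
  assumes "m \<le> k"
  shows "k * (k - m) ^ m \<le> (k choose Suc m) * fact (Suc m)"
  using assms
proof (induction m)
  case (Suc m)
  have step: "(k choose Suc (Suc m)) * Suc (Suc m) = (k - Suc m) * (k choose Suc m)"
    using binomial_absorb_comp[of k "Suc m"] binomial_absorption[of "Suc m" k] by (simp add: mult_ac)
  have "k * (k - Suc m) ^ Suc m \<le> (k - Suc m) * (k * (k - m) ^ m)"
    by (simp add: mult_ac power_mono)
  also have "\<dots> \<le> (k - Suc m) * ((k choose Suc m) * fact (Suc m))"
    using Suc by (intro mult_left_mono) auto
  also have "\<dots> = (k choose Suc (Suc m)) * fact (Suc (Suc m))"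
    unfolding fact_Suc[of "Suc m"] of_nat_id mult.assoc[symmetric] step by (simp only: mult_ac)
  finally show ?case .
qed simp

text \<open>Bernoulli's inequality gives \<open>(1 - m/k)^m \<ge> 1 - m^2/k \<ge> 1/2\<close>, so
  replacing \<open>k - m\<close> by \<open>k\<close> in the previous bound costs at most a factor
  2.\<close>

lemma binomial_ge_half_power:
  assumes "2 * m\<^sup>2 \<le> k"
  shows "real k ^ Suc m \<le> 2 * real (k choose Suc m) * fact (Suc m)"
proof (cases "k = 0")
  case False
  have mk: "m \<le> k"
    using assms by (cases m) (auto simp: power2_eq_square)
  have "m * m / real k \<le> 1 / 2"
    using False of_nat_mono[OF assms, where ?'a = real] by (simp add: field_simps power2_eq_square)
  then have "1 / 2 \<le> 1 + real m * (- (real m / real k))" by simp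
  also have "\<dots> \<le> (1 + - (real m / real k)) ^ m"
    using False mk by (intro Bernoulli_inequality) auto
  also have "\<dots> = ((real k - real m) / real k) ^ m"
    using False by (simp add: field_simps)
  finally have "real k ^ m \<le> 2 * (real k - real m) ^ m"
    using False by (simp add: field_simps)
  then have "real k ^ Suc m \<le> 2 * (real k * (real k - real m) ^ m)"
    using mult_left_mono[of "real k ^ m" "2 * (real k - real m) ^ m" "real k"] by (simp add: mult_ac)
  also have "\<dots> = 2 * real (k * (k - m) ^ m)"
    using mk by (simp add: of_nat_diff)
  also have "\<dots> \<le> 2 * real ((k choose Suc m) * fact (Suc m))"
    by (intro mult_left_mono of_nat_mono binomial_ge_power mk) auto
  finally show ?thesis by (simp only: of_nat_mult of_nat_fact mult.assoc)
qed simp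

section \<open>Factorial estimates and the asymptotics of the constant\<close>

text \<open>The lower half of a crude Stirling estimate, by induction from
  \<open>(1 + 1/n)^n \<le> exp 1\<close>.\<close>

lemma power_self_le_exp_fact: "real n ^ n \<le> exp n * fact n"
proof (induction n)
  case (Suc n)
  show ?case
  proof (cases "n = 0")
    case False
    have "real (Suc n) ^ n = real n ^ n * (1 + 1 / real n) ^ n"
      using False by (simp add: field_simps flip: power_mult_distrib)
    also have "\<dots> \<le> (exp n * fact n) * exp 1"
      using exp_ge_one_plus_x_over_n_power_n[of n 1] False
      by (intro mult_mono Suc) auto
    finally have "real (Suc n) * real (Suc n) ^ n \<le> real (Suc n) * (exp n * fact n * exp 1)"
      by (intro mult_left_mono) auto
    then show ?thesis
      by (simp add: exp_add mult_ac)
  qed simp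
qed simp

text \<open>The upper half, by induction from \<open>(1 - 1/(n+1))^(n+1) \<le> exp (-1)\<close>. The
  loss of a factor \<open>exp 1 * n\<close> is harmless: its \<open>n\<close>-th root tends to
  1.\<close>

lemma exp_fact_le_power_self:
  assumes "n \<ge> 1"
  shows "exp n * fact n \<le> exp 1 * real n ^ Suc n"
  using assms
proof (induction n rule: dec_induct)
  case (step n)
  have "(1 - 1 / real (Suc n)) ^ Suc n \<le> exp (-1)"
    using exp_ge_one_minus_x_over_n_power_n[of 1 "Suc n"] by simp
  moreover have "1 - 1 / real (Suc n) = real n / real (Suc n)"
    by (simp add: field_simps)
  ultimately have *: "exp 1 * real n ^ Suc n \<le> real (Suc n) ^ Suc n"
    by (simp only: power_divide exp_minus) (simp add: divide_simps mult_ac del: power_Suc)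
  have "exp (Suc n) * fact (Suc n) = (exp 1 * real (Suc n)) * (exp n * fact n)"
    by (simp add: exp_add mult_ac)
  also have "\<dots> \<le> (exp 1 * real (Suc n)) * (exp 1 * real n ^ Suc n)"
    by (intro mult_left_mono step) auto
  also have "\<dots> \<le> (exp 1 * real (Suc n)) * real (Suc n) ^ Suc n"
    by (intro mult_left_mono *) auto
  finally show ?case by (simp add: mult_ac)
qed simp

lemma root_fact_asymp:
  fixes C :: real
  assumes C: "C > 0"
  shows "(\<lambda>r. (C * fact (Suc r)) powr (1 / real r) / (real r / exp 1)) \<longlonglongrightarrow> 1"
proof -
  \<comment> \<open>The \<open>r\<close>-th power of the ratio in question. It lies between the
    constant \<open>C\<close> and a quadratic polynomial in \<open>r\<close>, and the
    \<open>r\<close>-th roots of both tend to 1.\<close>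
  define g where "g r = C * fact (Suc r) * (exp r / real r ^ r)" for r
  have eq: "(C * fact (Suc r)) powr (1 / real r) / (real r / exp 1) = g r powr (1 / real r)"
    if "r \<ge> 1" for r
  proof -
    have "exp r / real r ^ r = (exp 1 / real r) powr real r"
      using that by (simp add: powr_realpow power_divide flip: exp_of_nat_mult)
    then have "(exp r / real r ^ r) powr (1 / real r) = exp 1 / real r"
      using that by (simp add: powr_powr)
    then show ?thesis
      unfolding g_def using C by (subst powr_mult) auto
  qed
  have low: "C \<le> g r" if "r \<ge> 1" for r
  proof -
    have "1 \<le> fact r * exp r / real r ^ r"
      using power_self_le_exp_fact[of r] that by (simp add: field_simps)
    moreover have "fact r * exp r / real r ^ r \<le> fact (Suc r) * exp r / real r ^ r"
      by (intro divide_right_mono mult_right_mono fact_mono) auto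
    ultimately have "C * 1 \<le> C * (fact (Suc r) * exp r / real r ^ r)"
      using C by (intro mult_left_mono) auto
    then show ?thesis by (simp add: g_def mult_ac)
  qed
  have up: "g r \<le> C * (real r + 1) * exp 1 * real r" if "r \<ge> 1" for r
  proof -
    have "exp r * fact r / real r ^ r \<le> exp 1 * real r"
      using exp_fact_le_power_self[OF that] that by (simp add: field_simps)
    then have "(C * (real r + 1)) * (exp r * fact r / real r ^ r) \<le> (C * (real r + 1)) * (exp 1 * real r)"
      using C by (intro mult_left_mono) auto
    then show ?thesis by (simp add: g_def mult_ac add_ac)
  qed
  have "(\<lambda>r. g r powr (1 / real r)) \<longlonglongrightarrow> 1"
  proof (rule tendsto_sandwich)
    show "\<forall>\<^sub>F r in sequentially. C powr (1 / real r) \<le> g r powr (1 / real r)"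
      using eventually_ge_at_top[of 1] by eventually_elim (use C low in \<open>auto intro!: powr_mono2\<close>)
    show "\<forall>\<^sub>F r in sequentially. g r powr (1 / real r) \<le> (C * (real r + 1) * exp 1 * real r) powr (1 / real r)"
      using eventually_ge_at_top[of 1]
    proof eventually_elim
      case (elim r)
      then show ?case using up[of r] low[of r] C by (intro powr_mono2) auto
    qed
    show "(\<lambda>r. C powr (1 / real r)) \<longlonglongrightarrow> 1" using C by real_asymp
    show "(\<lambda>r. (C * (real r + 1) * exp 1 * real r) powr (1 / real r)) \<longlonglongrightarrow> 1" using C by real_asymp
  qed
  moreover have "\<forall>\<^sub>F r in sequentially.
      g r powr (1 / real r) = (C * fact (Suc r)) powr (1 / real r) / (real r / exp 1)"
    using eventually_ge_at_top[of 1] by eventually_elim (rule eq[symmetric])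
  ultimately show ?thesis
    by (rule Lim_transform_eventually)
qed

section \<open>Choice of parameters for a fixed number of vertices\<close>

lemma binomial_le_power: "n choose k \<le> n ^ k"
  by (cases "k \<le> n") (auto simp: binomial_le_pow binomial_eq_0)

text \<open>The asymptotic hypotheses enter only as explicit inequalities: \<open>d_large\<close>
  controls the degree term of the union bound, \<open>ln n \<le> 2 * L\<close> the number of
  \<open>k\<close>-sets, and \<open>nd_large\<close> makes \<open>k\<close> big enough for
  \<open>binomial_ge_half_power\<close>.\<close>

lemma exists_hypergraph_max_degree_eq:
  fixes n d r :: nat
  defines "L \<equiv> ln (real n / real d)"
  assumes r: "r \<ge> 1" and d0: "d > 0" and dn: "d + r \<le> n"
    and lnn: "ln (real n) \<ge> 2" "ln (real n) \<le> 2 * L"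
    and d_large: "2 * (real r + 1) * ln (real n) \<le> real d"
    and nd_large: "real (2 * r\<^sup>2) ^ r \<le> real n / real d"
  shows "\<exists>(V :: nat set) E. uniform_hypergraph (Suc r) V E \<and> card V = n \<and> max_degree r V E = d \<and>
    real (independence_number V E)
      \<le> (24 * fact (Suc r)) powr (1 / real r) * (real n / real d * L) powr (1 / real r)"
proof -
  define C :: real where "C = 24 * fact (Suc r)"
  define B where "B = C powr (1 / real r) * (real n / real d * L) powr (1 / real r)"
  \<comment> \<open>The least integer above \<open>B\<close>: having no independent
    \<open>k\<close>-set means independence number at most the floor of \<open>B\<close>.\<close>
  define k where "k = Suc (nat \<lfloor>B\<rfloor>)"
  define p where "p = real d / (4 * real n)"
  have L: "L \<ge> 1" using lnn by simp
  have n0: "n > 0" using d0 dn by simp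
  have p: "0 \<le> p" "p \<le> 1"
    using dn n0 by (auto simp: p_def field_simps)
  have C: "C \<ge> 24" unfolding C_def using fact_ge_1[of "Suc r", where ?'a = real] by linarith
  have B0: "B \<ge> 0" by (simp add: B_def)
  have Bk: "B \<le> real k" unfolding k_def by linarith
  have k1: "real k \<ge> 1" by (simp add: k_def)
  have Br: "B ^ r = C * (real n / real d * L)"
  proof -
    have "(x powr (1 / real r)) ^ r = x" if "x > 0" for x :: real
      using that r by (subst powr_realpow[symmetric]) (auto simp: powr_powr)
    then show ?thesis
      using L n0 d0 C by (simp add: B_def power_mult_distrib)
  qed
  have "real (2 * r\<^sup>2) \<le> B"
  proof -
    have "1 * (real n / real d) * 1 \<le> C * (real n / real d) * L"
      using L C by (intro mult_mono) auto
    then have "real (2 * r\<^sup>2) ^ r \<le> B ^ r"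
      using nd_large unfolding Br by (simp add: mult.assoc)
    then show ?thesis using B0 r by (subst (asm) power_mono_iff) auto
  qed
  then have k_large: "2 * r\<^sup>2 \<le> k" using Bk by linarith
  have "real (n choose r) * (1 + 2 * p) ^ n * exp (- real d)
      \<le> real n ^ r * exp (real d / 2) * exp (- real d)"
  proof (intro mult_right_mono mult_mono)
    show "real (n choose r) \<le> real n ^ r"
      using of_nat_mono[OF binomial_le_power, of n r, where ?'a = real] by simp
    have "1 + 2 * p = 1 + (real d / 2) / real n"
      by (simp add: p_def)
    then show "(1 + 2 * p) ^ n \<le> exp (real d / 2)"
      using n0 exp_ge_one_plus_x_over_n_power_n[of n "real d / 2"] by simp
  qed (use p in auto)
  also have "real n ^ r = exp (real r * ln (real n))"
    using n0 by (simp add: exp_of_nat_mult)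
  also have "exp (real r * ln (real n)) * exp (real d / 2) * exp (- real d)
      = exp (real r * ln (real n) - real d / 2)"
    unfolding exp_add[symmetric] by simp
  \<comment> \<open>By \<open>d_large\<close> the exponent is at most \<open>- ln n\<close>, which
    is at most -2.\<close>
  also have "\<dots> \<le> exp (- 2)"
  proof -
    have "2 * (real r * ln (real n)) + 2 * ln (real n) \<le> real d"
      using d_large by (simp only: distrib_left distrib_right mult.assoc mult_1)
    then show ?thesis using lnn(1) by simp
  qed
  also have "\<dots> < 1 / 2"
    using exp_ge_add_one_self[of 2] by (simp add: exp_minus field_simps)
  finally have first: "real (n choose r) * (1 + 2 * p) ^ n * exp (- real d) < 1 / 2" .
  \<comment> \<open>The constant 24 is 4 * 2 * 3: the 4 from \<open>p\<close>, the 2 from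
    \<open>binomial_ge_half_power\<close>, and the 3 in order to beat the factor 2 in
    \<open>exp (2 * real k * L)\<close>, the bound on the number of \<open>k\<close>-sets.\<close>
  have pk: "3 * real k * L \<le> p * real (k choose Suc r)"
  proof -
    have "real k * B ^ r \<le> real k ^ Suc r"
      using B0 Bk by (simp add: mult_left_mono power_mono)
    also have "\<dots> \<le> 2 * real (k choose Suc r) * fact (Suc r)"
      by (rule binomial_ge_half_power[OF k_large])
    finally have "p / (2 * fact (Suc r)) * (real k * B ^ r)
        \<le> p / (2 * fact (Suc r)) * (2 * real (k choose Suc r) * fact (Suc r))"
      using p by (intro mult_left_mono) auto
    moreover have "p / (2 * fact (Suc r)) * (real k * B ^ r) = 3 * real k * L"
      unfolding Br p_def C_def using n0 d0 by (simp add: divide_simps del: fact_Suc)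
    moreover have "p / (2 * fact (Suc r)) * (2 * real (k choose Suc r) * fact (Suc r))
        = p * real (k choose Suc r)"
      by (simp del: fact_Suc)
    ultimately show ?thesis by simp
  qed
  have "real (n choose k) * (1 - p) ^ (k choose Suc r)
      \<le> exp (2 * real k * L) * exp (- (3 * real k * L))"
  proof (rule mult_mono)
    have "real (n choose k) \<le> real n ^ k"
      using of_nat_mono[OF binomial_le_power, of n k, where ?'a = real] by simp
    also have "\<dots> = exp (real k * ln (real n))"
      using n0 by (simp add: exp_of_nat_mult)
    also have "\<dots> \<le> exp (2 * real k * L)"
      using lnn mult_left_mono[of "ln (real n)" "2 * L" "real k"] by (simp add: mult_ac)
    finally show "real (n choose k) \<le> exp (2 * real k * L)" .
    have "(1 - p) ^ (k choose Suc r) \<le> exp (- p) ^ (k choose Suc r)"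
      using p exp_ge_add_one_self[of "- p"] by (intro power_mono) auto
    also have "\<dots> = exp (- (p * real (k choose Suc r)))"
      by (simp add: mult_ac flip: exp_of_nat_mult)
    also have "\<dots> \<le> exp (- (3 * real k * L))"
      using pk by simp
    finally show "(1 - p) ^ (k choose Suc r) \<le> exp (- (3 * real k * L))" .
  qed (use p in auto)
  also have "\<dots> = exp (- (real k * L))"
    by (simp flip: exp_add)
  also have "\<dots> \<le> exp (- 1)"
    using mult_mono[of 1 "real k" 1 L] k1 L by simp
  also have "\<dots> \<le> 1 / 2"
    using exp_ge_add_one_self[of 1] by (simp add: exp_minus field_simps)
  finally have second: "real (n choose k) * (1 - p) ^ (k choose Suc r) \<le> 1 / 2" .
  obtain E where E: "uniform_hypergraph (Suc r) {..<n} E"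
    "\<And>R. R \<subseteq> {..<n} \<Longrightarrow> card R = r \<Longrightarrow> set_degree E R \<le> d"
    "\<And>S. S \<subseteq> {..<n} \<Longrightarrow> card S = k \<Longrightarrow> \<exists>e\<in>E. e \<subseteq> S"
    using exists_hypergraph_low_degree_no_large_independent[of "{..<n}" p r d k] first second p
    by auto
  obtain E' where E': "E \<subseteq> E'" "uniform_hypergraph (Suc r) {..<n} E'" "max_degree r {..<n} E' = d"
    using extend_to_max_degree_eq[OF E(1,2)] dn by auto
  \<comment> \<open>Every \<open>k\<close>-set contains an edge of \<open>E\<close>, hence one of
    the larger set \<open>E'\<close>.\<close>
  have "independence_number {..<n} E' \<le> nat \<lfloor>B\<rfloor>"
    using E(3) E'(1) by (intro independence_number_le[OF E'(2)]) (fold k_def, blast)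
  then have "real (independence_number {..<n} E') \<le> B"
    using B0 by linarith
  then show ?thesis
    using E' unfolding B_def C_def by (intro exI[of _ "{..<n}"] exI[of _ E']) simp
qed

section \<open>Passage to all sufficiently large \<open>n\<close>\<close>

theorem mainTheorem3:
  "\<exists>b :: nat \<Rightarrow> real.
     (\<forall>r\<ge>2. b r > 0) \<and>
     (\<lambda>r. b r / (real r / exp 1)) \<longlonglongrightarrow> 1 \<and>
     (\<forall>r\<ge>2. \<forall>d :: nat \<Rightarrow> nat.
        (\<forall>n\<ge>1. d n > 0) \<longrightarrow>
        filterlim (\<lambda>n. real (d n) / ln (real n)) at_top sequentially \<longrightarrow>
        (\<lambda>n. ln (real (d n)) / ln (real n)) \<longlonglongrightarrow> 0 \<longrightarrow>
        (\<forall>\<^sub>F n in sequentially.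
           \<exists>(V :: nat set) (E :: nat set set).
             uniform_hypergraph (r + 1) V E \<and> card V = n \<and>
             max_degree r V E = d n \<and>
             real (independence_number V E)
               \<le> b r * (real n / real (d n) * ln (real n / real (d n))) powr (1 / real r)))"
proof (intro exI[of _ "\<lambda>r. (24 * fact (Suc r)) powr (1 / real r)"] conjI allI impI)
  show "(\<lambda>r. (24 * fact (Suc r)) powr (1 / real r) / (real r / exp 1)) \<longlonglongrightarrow> 1"
    by (rule root_fact_asymp) simp
next
  fix r :: nat
  show "0 < (24 * fact (Suc r) :: real) powr (1 / real r)"
    by (simp del: fact_Suc)
next
  fix r :: nat and d :: "nat \<Rightarrow> nat"
  assume r: "2 \<le> r" and pos: "\<forall>n\<ge>1. d n > 0"
    and big: "filterlim (\<lambda>n. real (d n) / ln (real n)) at_top sequentially"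
    and subpoly: "(\<lambda>n. ln (real (d n)) / ln (real n)) \<longlonglongrightarrow> 0"
  have "\<forall>\<^sub>F n in sequentially. 2 * (real r + 1) \<le> real (d n) / ln (real n)"
    using big by (simp add: filterlim_at_top)
  \<comment> \<open>The threshold 1/2 amounts to \<open>d n < sqrt n\<close>. It yields
    \<open>ln n \<le> 2 * ln (n / d n)\<close> and \<open>n / d n \<ge> sqrt n\<close>, which
    outgrows the constant \<open>(2 * r^2)^r\<close>.\<close>
  moreover have "\<forall>\<^sub>F n in sequentially. ln (real (d n)) / ln (real n) < 1 / 2"
    using subpoly by (rule order_tendstoD) simp
  moreover have "\<forall>\<^sub>F n in sequentially. ln (real n) \<ge> 2"
    by real_asymp
  moreover have "\<forall>\<^sub>F n in sequentially. sqrt (real n) + real r \<le> real n"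
    by real_asymp
  moreover have "\<forall>\<^sub>F n in sequentially. real (2 * r\<^sup>2) ^ r \<le> sqrt (real n)"
    by real_asymp
  ultimately show "\<forall>\<^sub>F n in sequentially. \<exists>(V :: nat set) (E :: nat set set).
             uniform_hypergraph (r + 1) V E \<and> card V = n \<and> max_degree r V E = d n \<and>
             real (independence_number V E)
               \<le> (24 * fact (Suc r)) powr (1 / real r)
                 * (real n / real (d n) * ln (real n / real (d n))) powr (1 / real r)"
    using eventually_ge_at_top[of 1]
  proof eventually_elim
    case (elim n)
    have n: "n \<ge> 1" "d n > 0" using elim pos by auto
    have "0 < ln (real n)" using elim by linarith
    then have ln_d: "ln (real (d n)) < ln (real n) / 2"
      using elim(2) by (simp add: pos_divide_less_eq)
    then have "ln (real (d n)) < ln (sqrt (real n))"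
      using n by (simp add: ln_sqrt)
    then have d_le: "real (d n) \<le> sqrt (real n)"
      using n by simp
    have "ln (real n / real (d n)) = ln (real n) - ln (real (d n))"
      using n by (simp add: ln_div)
    then have "ln (real n) \<le> 2 * ln (real n / real (d n))"
      using ln_d by simp
    \<comment> \<open>From \<open>d n \<le> sqrt n\<close> and the eventual bound
      \<open>sqrt n + r \<le> n\<close>.\<close>
    moreover have "d n + r \<le> n" using elim d_le by linarith
    moreover have "2 * (real r + 1) * ln (real n) \<le> real (d n)"
      using elim(1) \<open>0 < ln (real n)\<close> by (simp only: pos_le_divide_eq)
    moreover have "sqrt (real n) \<le> real n / real (d n)"
    proof -
      have "sqrt (real n) * real (d n) \<le> sqrt (real n) * sqrt (real n)"
        using d_le by (intro mult_left_mono) auto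
      then show ?thesis using n by (simp add: field_simps)
    qed
    ultimately show ?case
      using exists_hypergraph_max_degree_eq[of r "d n" n] elim r n by simp
  qed
qed

end
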